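(* Let $(\alpha_n,\beta_n)_{n\in\mathbb{Z}}$ be a bilateral Bailey pair relative to $a$, let $N\geq0$ be an integer and $\rho,\sigma$ complex parameters. Define for $n\in\mathbb{Z}$ \[ \alpha'_n=(1-aq^{2n-N})(aq^{1-N})_N\sum_{j=0}^N(-1)^j\frac{a^jq^{(2n-N)j-j(j+1)/2}}{(aq^{2n-N-j})_{N+1}}\begin{bmatrix}N\\ j\end{bmatrix}\frac{(\rho,\sigma)_{n-j}(aq/\rho\sigma)^{n-j}}{(aq/\rho,aq/\sigma)_{n-j}}\alpha_{n-j}, \] \[ \beta'_n=\sum_{j\le n}\frac{(\rho,\sigma)_j(aq/\rho\sigma)_{n-j}(aq/\rho\sigma)^j}{(q)_{n-j}(aq/\rho,aq/\sigma)_n}\beta_j . \] Then, subject to convergence conditions on $\alpha_n,\beta_n$ making all the relevant infinite series absolutely convergent, $(\alpha'_n,\beta'_n)$ is a bilateral Bailey pair relative to $aq^{-N}$.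
   Context: Fix complex numbers $a,q$ with $|q|<1$ (parameters generic so that no denominator vanishes). For complex $x$, $(x)_\infty=\prod_{j\ge0}(1-xq^j)$ and for $k\in\mathbb{Z}$, $(x)_k=(x)_\infty/(xq^k)_\infty$ (so $1/(q)_k=0$ for $k<0$); $(x_1,\dots,x_m)_k=(x_1)_k\cdots(x_m)_k$. A bilateral Bailey pair relative to $c$ is a pair of sequences $(\alpha_n)_{n\in\mathbb{Z}},(\beta_n)_{n\in\mathbb{Z}}$ such that for every $n\in\mathbb{Z}$, $\beta_n=\sum_{j\le n}\frac{\alpha_j}{(q)_{n-j}(cq)_{n+j}}$ (the series being convergent). For integers $N\ge0$ and $j$, $\begin{bmatrix}N\\ j\end{bmatrix}=\frac{(q)_N}{(q)_j(q)_{N-j}}$ if $0\le j\le N$ and $0$ otherwise. *)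

theory Defs
  imports "HOL-Analysis.Analysis"
begin

definition qpoch_inf :: "complex \<Rightarrow> complex \<Rightarrow> complex" where
  "qpoch_inf q x = (\<Prod>j. 1 - x * q ^ j)"

text \<open>
  The quotient is meaningful as long as its denominator does not vanish. If only the denominator
  vanishes, \<open>(x)\<^sub>k\<close> has a pole; as division by zero yields zero, \<open>1 / qpoch q x k = 0\<close> is then the
  intended value of the reciprocal (in particular \<open>1/(q)\<^sub>k = 0\<close> for \<open>k < 0\<close>). The case in which
  numerator and denominator both vanish has no meaning and must be excluded by hypotheses.
\<close>

definition qpoch :: "complex \<Rightarrow> complex \<Rightarrow> int \<Rightarrow> complex" where
  "qpoch q x k = qpoch_inf q x / qpoch_inf q (x * q powi k)"

definition qbinom :: "complex \<Rightarrow> nat \<Rightarrow> int \<Rightarrow> complex" where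
  "qbinom q N j = (if 0 \<le> j \<and> j \<le> int N
     then qpoch q q (int N) / (qpoch q q j * qpoch q q (int N - j)) else 0)"

text \<open>
  A series over all integers \<open>j \<le> n\<close> is the ordinary (possibly only conditionally convergent)
  series over \<open>k = 0, 1, 2, \<dots>\<close> with \<open>j = n - k\<close>.
\<close>

definition bilateral_bailey_pair ::
    "complex \<Rightarrow> complex \<Rightarrow> (int \<Rightarrow> complex) \<Rightarrow> (int \<Rightarrow> complex) \<Rightarrow> bool" where
  "bilateral_bailey_pair q c \<alpha> \<beta> \<longleftrightarrow>
     (\<forall>n. (\<lambda>k::nat. let j = n - int k in
             \<alpha> j / (qpoch q q (n - j) * qpoch q (c * q) (n + j))) sums \<beta> n)"

definition lattice_alpha ::
    "complex \<Rightarrow> complex \<Rightarrow> complex \<Rightarrow> complex \<Rightarrow> nat \<Rightarrow> (int \<Rightarrow> complex) \<Rightarrow> int \<Rightarrow> complex" where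
  "lattice_alpha q a \<rho> \<sigma> N \<alpha> n =
     (1 - a * q powi (2 * n - int N)) * qpoch q (a * q powi (1 - int N)) (int N) *
     (\<Sum>j = 0..int N.
        (-1) powi j *
        (a powi j * q powi ((2 * n - int N) * j - j * (j + 1) div 2)
           / qpoch q (a * q powi (2 * n - int N - j)) (int N + 1)) *
        qbinom q N j *
        (qpoch q \<rho> (n - j) * qpoch q \<sigma> (n - j) * (a * q / (\<rho> * \<sigma>)) powi (n - j)
           / (qpoch q (a * q / \<rho>) (n - j) * qpoch q (a * q / \<sigma>) (n - j))) *
        \<alpha> (n - j))"

definition lattice_beta_coeff ::
    "complex \<Rightarrow> complex \<Rightarrow> complex \<Rightarrow> complex \<Rightarrow> int \<Rightarrow> int \<Rightarrow> complex" where
  "lattice_beta_coeff q a \<rho> \<sigma> n j =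
     qpoch q \<rho> j * qpoch q \<sigma> j * qpoch q (a * q / (\<rho> * \<sigma>)) (n - j)
       * (a * q / (\<rho> * \<sigma>)) powi j
     / (qpoch q q (n - j) * (qpoch q (a * q / \<rho>) n * qpoch q (a * q / \<sigma>) n))"

definition lattice_beta ::
    "complex \<Rightarrow> complex \<Rightarrow> complex \<Rightarrow> complex \<Rightarrow> (int \<Rightarrow> complex) \<Rightarrow> int \<Rightarrow> complex" where
  "lattice_beta q a \<rho> \<sigma> \<beta> n =
     (\<Sum>k::nat. let j = n - int k in lattice_beta_coeff q a \<rho> \<sigma> n j * \<beta> j)"

text \<open>
  Absolute convergence, for every \<open>n\<close>, of the double series over \<open>r \<le> j \<le> n\<close> that arises from
  \<open>\<beta>'\<^sub>n\<close> by inserting the series defining \<open>\<beta>\<^sub>j\<close>. For generic parameters it entails absolute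
  convergence of the series for \<open>\<beta>\<^sub>n\<close>, of the series defining \<open>\<beta>'\<^sub>n\<close>, and of the series over
  \<open>\<alpha>'\<close> in the Bailey pair relation relative to \<open>a q\<^sup>-\<^sup>N\<close>.
\<close>

definition lattice_abs_convergent ::
    "complex \<Rightarrow> complex \<Rightarrow> complex \<Rightarrow> complex \<Rightarrow> (int \<Rightarrow> complex) \<Rightarrow> bool" where
  "lattice_abs_convergent q a \<rho> \<sigma> \<alpha> \<longleftrightarrow>
     (\<forall>n. (\<lambda>(j, r). norm (lattice_beta_coeff q a \<rho> \<sigma> n j *
                           (\<alpha> r / (qpoch q q (j - r) * qpoch q (a * q) (j + r)))))
            summable_on {(j, r). r \<le> j \<and> j \<le> n})"

end

theory Submission
  imports Defs
begin

text \<open>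
  Insert the series for \<open>\<beta>\<^sub>j\<close> into \<open>\<beta>'\<^sub>n\<close> and exchange the two sums. The inner sum is finite and is
  evaluated by the \<open>q\<close>-Pfaff--Saalschuetz formula, which gives
  \<open>\<beta>'\<^sub>n = \<Sum>\<^sub>r \<alpha>''\<^sub>r / ((q)\<^bsub>n-r\<^esub> (aq)\<^bsub>n+r\<^esub>)\<close> with
  \<open>\<alpha>''\<^sub>r = (\<rho>, \<sigma>)\<^sub>r (aq/\<rho>\<sigma>)\<^sup>r / (aq/\<rho>, aq/\<sigma>)\<^sub>r \<alpha>\<^sub>r\<close>: this is the Bailey lemma relative to \<open>a\<close>.
  A terminating very-well-poised \<open>\<^sub>6\<phi>\<^sub>5\<close> summation expands the kernel \<open>1 / ((q)\<^bsub>n-r\<^esub> (aq)\<^bsub>n+r\<^esub>)\<close> as a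
  combination of the kernels relative to \<open>a q\<^bsup>-N\<^esup>\<close> at \<open>r, \<dots>, r + N\<close>. Each term of this expansion is a
  bounded multiple of the original kernel as \<open>r \<rightarrow> -\<infinity>\<close>, so the series may be rearranged. Both summations
  are proved by telescoping with an explicit rational certificate.
\<close>

section \<open>Finite and infinite q-Pochhammer symbols\<close>

definition qpoch_fin :: "complex \<Rightarrow> complex \<Rightarrow> nat \<Rightarrow> complex" where
  "qpoch_fin q x k = (\<Prod>i<k. 1 - x * q ^ i)"

lemma qpoch_fin_0 [simp]: "qpoch_fin q x 0 = 1"
  by (simp add: qpoch_fin_def)

lemma qpoch_fin_Suc: "qpoch_fin q x (Suc k) = qpoch_fin q x k * (1 - x * q ^ k)"
  by (simp add: qpoch_fin_def)

lemma qpoch_fin_add: "qpoch_fin q x (m + k) = qpoch_fin q x m * qpoch_fin q (x * q ^ m) k"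
  by (induction k) (auto simp: qpoch_fin_Suc power_add mult_ac)

lemma qpoch_fin_nonzero: "(\<And>i. i < k \<Longrightarrow> x * q ^ i \<noteq> 1) \<Longrightarrow> qpoch_fin q x k \<noteq> 0"
  by (auto simp: qpoch_fin_def)

lemma sum_atMost_telescope:
  fixes G :: "nat \<Rightarrow> 'a :: ab_group_add"
  shows "(\<Sum>k\<le>n. G (Suc k) - G k) = G (Suc n) - G 0"
  by (induction n) auto

lemma power_Suc_neq_1:
  fixes q :: complex
  assumes "norm q < 1"
  shows "q * q ^ k \<noteq> 1"
  by (metis assms norm_one norm_power power_Suc power_less_one_iff norm_ge_zero zero_less_Suc
      less_irrefl)

lemma qpoch_fin_q_nonzero:
  assumes "norm q < 1"
  shows "qpoch_fin q q k \<noteq> 0"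
  by (intro qpoch_fin_nonzero power_Suc_neq_1 assms)

lemma has_prod_qpoch_inf:
  assumes "norm q < 1"
  shows "(\<lambda>j. 1 - x * q ^ j) has_prod qpoch_inf q x"
proof -
  have "summable (\<lambda>j. norm ((1 - x * q ^ j) - 1))"
    using assms by (auto simp: norm_mult norm_power intro!: summable_mult summable_geometric)
  then have "convergent_prod (\<lambda>j. 1 - x * q ^ j)"
    by (intro abs_convergent_prod_imp_convergent_prod summable_imp_abs_convergent_prod)
  then show ?thesis
    unfolding qpoch_inf_def by (rule convergent_prod_has_prod)
qed

lemma qpoch_inf_eq_0_iff:
  assumes "norm q < 1"
  shows "qpoch_inf q x = 0 \<longleftrightarrow> (\<exists>j. x * q ^ j = 1)"
  using has_prod_eq_0_iff[OF has_prod_qpoch_inf[OF assms]] by (auto simp: image_iff) 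

lemma qpoch_inf_split:
  assumes "norm q < 1"
  shows "qpoch_inf q x = qpoch_fin q x k * qpoch_inf q (x * q ^ k)"
\<comment> \<open>Splitting off an initial segment of the product requires its factors to be
  nonzero. If one of them vanishes, both sides are 0.\<close>
proof (cases "\<exists>i<k. x * q ^ i = 1")
  case True
  then have "qpoch_inf q x = 0" "qpoch_fin q x k = 0"
    by (auto simp: qpoch_inf_eq_0_iff assms qpoch_fin_def)
  then show ?thesis by simp
next
  case False
  then have nz: "\<And>i. i < k \<Longrightarrow> 1 - x * q ^ i \<noteq> 0"
    by auto
  have "(\<lambda>i. 1 - x * q ^ (i + k)) has_prod (qpoch_inf q x / qpoch_fin q x k)"
    unfolding qpoch_fin_def
    by (rule has_prod_split_initial_segment[OF has_prod_qpoch_inf[OF assms] nz])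
  then have "(\<lambda>i. 1 - x * q ^ k * q ^ i) has_prod (qpoch_inf q x / qpoch_fin q x k)"
    by (simp add: power_add mult_ac)
  then have "qpoch_inf q x / qpoch_fin q x k = qpoch_inf q (x * q ^ k)"
    using has_prod_qpoch_inf[OF assms] has_prod_unique2 by blast
  moreover have "qpoch_fin q x k \<noteq> 0"
    using False by (auto intro!: qpoch_fin_nonzero)
  ultimately show ?thesis
    by (simp add: field_simps)
qed

text \<open>Follows from 1/(x)_k = (x q^k)_inf / (x)_inf. In reciprocal form the possibly vanishing
  (x q^k)_inf is a numerator, so the shift may also cross poles of (x)_k, such as those of (q)_k for
  k < 0.\<close>

lemma inverse_qpoch_shift:
  assumes "norm q < 1" "q \<noteq> 0"
  shows "inverse (qpoch q x k) = qpoch_fin q (x * q powi k) m * inverse (qpoch q x (k + int m))"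
  using qpoch_inf_split[OF assms(1), of "x * q powi k" m] assms
  by (simp add: qpoch_def power_int_add field_simps)

lemma qpoch_add_nat:
  assumes "norm q < 1" "q \<noteq> 0" and "\<And>i. i < m \<Longrightarrow> x * q powi (k + int i) \<noteq> 1"
  shows "qpoch q x (k + int m) = qpoch q x k * qpoch_fin q (x * q powi k) m"
proof -
  have "qpoch_fin q (x * q powi k) m \<noteq> 0"
    using assms by (intro qpoch_fin_nonzero) (auto simp: power_int_add mult_ac)
  then show ?thesis
    using arg_cong[OF inverse_qpoch_shift[OF assms(1,2), of x k m], of inverse]
    by (simp add: field_simps)
qed

lemma qpoch_of_nat:
  assumes "norm q < 1" "q \<noteq> 0" "\<And>k. x * q ^ k \<noteq> 1"
  shows "qpoch q x (int k) = qpoch_fin q x k"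
proof -
  have "qpoch q x 0 = 1"
    using assms by (simp add: qpoch_def qpoch_inf_eq_0_iff)
  then show ?thesis
    using qpoch_add_nat[OF assms(1,2), of k x 0] assms(3) by simp
qed

lemma qpoch_q_of_nat:
  assumes "norm q < 1" "q \<noteq> 0"
  shows "qpoch q q (int k) = qpoch_fin q q k"
  by (intro qpoch_of_nat power_Suc_neq_1 assms)

text \<open>The product (q^(k+1))_inf contains the factor 1 - q^0, so the quotient has denominator
  0. Its default value 0 realises the convention 1/(q)_k = 0.\<close>

lemma qpoch_q_neg:
  assumes "norm q < 1" "q \<noteq> 0" "k < 0"
  shows "qpoch q q k = 0"
proof -
  have "q * q powi k * q ^ nat (- k - 1) = 1"
    using assms by (simp flip: power_int_of_nat power_int_add power_int_add_1')
  then have "qpoch_inf q (q * q powi k) = 0"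
    using assms qpoch_inf_eq_0_iff by blast
  then show ?thesis
    by (simp add: qpoch_def)
qed

section \<open>The q-Pfaff-Saalschuetz summation\<close>

text \<open>With \<open>u = q\<^sup>k\<close>, \<open>v = q\<^bsup>M-k\<^esup>\<close> and \<open>b q = c \<rho> \<sigma>\<close>, this is the Wilf--Zeilberger certificate.\<close>

lemma q_Saalschutz_certificate:
  fixes u v c q \<rho> \<sigma> :: complex
  shows "(1 - q*u* v) * (1 - c*\<rho>*\<sigma>*u* v) * (1 - c* v) - (1 - q* v) * (1 - c*\<sigma>*u* v) * (1 - c*\<rho>*u* v)
     = (1 - u) * (q - c*\<rho>*\<sigma>*u) * (1 - c* v) * v - c * (1 - q* v) * (1 - \<rho>*u) * (1 - \<sigma>*u) * v"
  by algebra

text \<open>For nonzero c this is the balanced 3phi2 with numerator parameters rho, sigma, q^(-M),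
  written as a convolution; b q = c rho sigma is the balancing condition. Both sides satisfy the
  same first-order recurrence in M and agree at M = 0.\<close>

lemma q_Pfaff_Saalschutz:
  fixes q b c \<rho> \<sigma> :: complex
  assumes q: "norm q < 1" and bc: "b * q = c * \<rho> * \<sigma>" and b: "\<And>i::nat. b * q * q ^ i \<noteq> 1"
  shows "(\<Sum>k\<le>M. qpoch_fin q \<rho> k * qpoch_fin q \<sigma> k * c ^ k / (qpoch_fin q q k * qpoch_fin q (b * q) k)
            * (qpoch_fin q c (M - k) / qpoch_fin q q (M - k)))
       = qpoch_fin q (c * \<sigma>) M * qpoch_fin q (c * \<rho>) M / (qpoch_fin q q M * qpoch_fin q (b * q) M)"
proof -
  define t where "t k = qpoch_fin q \<rho> k * qpoch_fin q \<sigma> k * c ^ k / (qpoch_fin q q k * qpoch_fin q (b * q) k)" for k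
  define s where "s m = qpoch_fin q c m / qpoch_fin q q m" for m
  define S where "S M = (\<Sum>k\<le>M. t k * s (M - k))" for M
  have qk: "1 - q * q ^ k \<noteq> 0" "1 - b * q * q ^ k \<noteq> 0" for k
    using power_Suc_neq_1[OF q] b by auto
  have P: "qpoch_fin q q k \<noteq> 0" "qpoch_fin q (b * q) k \<noteq> 0" for k
    using b qpoch_fin_nonzero qpoch_fin_q_nonzero q by auto
  have t_Suc: "(1 - q * q ^ k) * (1 - b * q * q ^ k) * t (Suc k) = c * (1 - \<rho> * q ^ k) * (1 - \<sigma> * q ^ k) * t k" for k
    using qk[of k] P by (simp add: t_def qpoch_fin_Suc divide_simps mult_ac)
  have s_Suc: "(1 - q * q ^ m) * s (Suc m) = (1 - c * q ^ m) * s m" for m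
    using qk[of m] P by (simp add: s_def qpoch_fin_Suc divide_simps mult_ac)
  have rec: "(1 - q * q ^ M) * (1 - b * q * q ^ M) * S (Suc M)
      = (1 - c * \<sigma> * q ^ M) * (1 - c * \<rho> * q ^ M) * S M" for M
  proof -
    \<comment> \<open>The factor 1 - q^k makes \<open>G 0\<close> vanish. \<open>G (Suc M)\<close>
      is, up to sign, the term k = M + 1 of \<open>S (Suc M)\<close> times the coefficient of the
      recurrence, so it supplies the one term that the sum up to M lacks.\<close>
    define G where "G k = - ((1 - q ^ k) * (1 - b * q ^ k) * t k * s (Suc M - k) * q ^ (Suc M - k))" for k
    have step: "(1 - q * q ^ M) * (1 - b * q * q ^ M) * (t k * s (Suc M - k))
        - (1 - c * \<sigma> * q ^ M) * (1 - c * \<rho> * q ^ M) * (t k * s (M - k)) = G (Suc k) - G k"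
      if "k \<le> M" for k
    proof -
      define u v where "u = q ^ k" and "v = q ^ (M - k)"
      have uv: "q ^ M = u * v"
        using that by (simp add: u_def v_def flip: power_add)
      have sk: "Suc M - k = Suc (M - k)"
        using that by simp
      have G1: "G (Suc k) = - (c * (1 - \<rho> * u) * (1 - \<sigma> * u) * t k * s (M - k) * v)"
        using t_Suc[of k] by (simp add: G_def u_def v_def mult_ac)
      have G0: "G k = - ((1 - u) * (1 - b * u) * t k * s (Suc (M - k)) * (q * v))"
        unfolding G_def sk by (simp add: u_def v_def)
      have sS: "(1 - q * v) * s (Suc (M - k)) = (1 - c * v) * s (M - k)"
        using s_Suc[of "M - k"] by (simp add: v_def)
      have nz: "1 - q * v \<noteq> 0"
        using qk[of "M - k"] by (simp add: v_def)
      \<comment> \<open>The certificate with c rho sigma replaced by b q. The extra factor 1 - q v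
        in the next step lets \<open>sS\<close> eliminate \<open>s (Suc (M - k))\<close>.\<close>
      have "(1 - q*(u* v)) * (1 - b*q*(u* v)) * (1 - c* v) - (1 - q* v) * (1 - c*\<sigma>*(u* v)) * (1 - c*\<rho>*(u* v))
     = (1 - u) * (1 - b*u) * (1 - c* v) * (q * v) - c * (1 - q* v) * (1 - \<rho>*u) * (1 - \<sigma>*u) * v"
        using q_Saalschutz_certificate[of q u v c \<rho> \<sigma>] bc by algebra
      then have "(1 - q * v) * ((1 - q*(u* v)) * (1 - b*q*(u* v)) * (t k * s (Suc (M - k)))
          - (1 - c*\<sigma>*(u* v)) * (1 - c*\<rho>*(u* v)) * (t k * s (M - k)))
        = (1 - q * v) * (- (c * (1 - \<rho> * u) * (1 - \<sigma> * u) * t k * s (M - k) * v)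
          - (- ((1 - u) * (1 - b * u) * t k * s (Suc (M - k)) * (q * v))))"
        using sS by algebra
      then show ?thesis
        unfolding G1 G0 uv sk using nz by (simp only: mult_cancel_left simp_thms)
    qed
    have "(1 - q * q ^ M) * (1 - b * q * q ^ M) * (\<Sum>k\<le>M. t k * s (Suc M - k))
        - (1 - c * \<sigma> * q ^ M) * (1 - c * \<rho> * q ^ M) * S M = (\<Sum>k\<le>M. G (Suc k) - G k)"
      unfolding S_def sum_distrib_left sum_subtractf[symmetric]
      by (intro sum.cong step) auto
    also have "\<dots> = G (Suc M)"
      by (simp add: sum_atMost_telescope G_def[of 0])
    also have "\<dots> = - ((1 - q * q ^ M) * (1 - b * q * q ^ M) * (t (Suc M) * s 0))"
      by (simp add: G_def)
    finally show ?thesis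
      unfolding S_def[of "Suc M"] by (simp add: algebra_simps)
  qed
  have "S M = qpoch_fin q (c * \<sigma>) M * qpoch_fin q (c * \<rho>) M / (qpoch_fin q q M * qpoch_fin q (b * q) M)"
  proof (induction M)
    case 0
    then show ?case by (simp add: S_def t_def s_def)
  next
    case (Suc M)
    have "S (Suc M) = (1 - c * \<sigma> * q ^ M) * (1 - c * \<rho> * q ^ M) * S M / ((1 - q * q ^ M) * (1 - b * q * q ^ M))"
      using rec[of M] qk[of M] by (simp add: eq_divide_eq mult_ac)
    then show ?case
      by (simp add: Suc.IH qpoch_fin_Suc mult_ac)
  qed
  then show ?thesis
    by (simp add: S_def t_def s_def)
qed

section \<open>The very-well-poised summation behind the change of base\<close>

text \<open>Wilf--Zeilberger certificate with \<open>u = q\<^sup>j\<close> and \<open>X = q\<^bsup>N+1\<^esup>\<close>.\<close>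

lemma change_of_base_certificate:
  fixes u b m X :: complex
  shows "((1 - X) * (1 - b*m*X) * u - (u - X) * (1 - b*X*u)) * (1 - b*u*u)
     = X * (u * b * (1 - b*u) * (u - m) * (u - X) + (1 - u) * (1 - b*m*u) * (1 - b*X*u))"
  by algebra

text \<open>For nonzero m this is the terminating 6phi5 sum with one free parameter equal to 1/m and
  the other sent to infinity. The factor \<open>w\<close> enters only through its recurrence, so
  that it may contain infinite products and may vanish from some index on. The proof is a
  first-order recurrence in N.\<close>

lemma change_of_base_sum:
  fixes q b m :: complex and w :: "nat \<Rightarrow> complex"
  assumes q: "norm q < 1" "q \<noteq> 0"
    and b: "\<And>i. b * q ^ i \<noteq> 1" and bm: "\<And>i. b * m * q * q ^ i \<noteq> 1"
    and w: "\<And>j. w (Suc j) * (1 - b * m * q * q ^ j) * q ^ j = w j * (q ^ j - m)"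
  shows "(\<Sum>j\<le>N. (1 - b * q ^ (2 * j)) * (- b) ^ j * q ^ (j + 3 * (j choose 2)) * qpoch_fin q b j
            / (qpoch_fin q b (N + j + 1) * qpoch_fin q q j * qpoch_fin q q (N - j)) * w j)
       = w 0 / (qpoch_fin q q N * qpoch_fin q (b * m * q) N)"
proof -
  define e where "e j = (1 - b * q ^ (2 * j)) * (- b) ^ j * q ^ (j + 3 * (j choose 2)) * qpoch_fin q b j
            / qpoch_fin q q j * w j" for j
  define h where "h N j = e j / (qpoch_fin q b (N + j + 1) * qpoch_fin q q (N - j))" for N j
  define H where "H N = (\<Sum>j\<le>N. h N j)" for N
  have qk: "1 - q * q ^ k \<noteq> 0" "1 - b * q ^ k \<noteq> 0" "1 - b * m * q * q ^ k \<noteq> 0" for k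
    using power_Suc_neq_1[OF q(1)] b bm by auto
  have P: "qpoch_fin q b k \<noteq> 0" "qpoch_fin q q k \<noteq> 0" for k
    using b qpoch_fin_nonzero qpoch_fin_q_nonzero q by auto
  have pw: "q ^ (2 * i) = q ^ i * q ^ i" for i
    by (simp add: mult_2 power_add)
  have rec: "(1 - q * q ^ N) * (1 - b * m * q * q ^ N) * H (Suc N) = H N" for N
  proof -
    define X where "X = q * q ^ N"
    \<comment> \<open>The rational certificate. It vanishes at j = 0; at j = N + 1, where q^j = X,
      the factor 1 - b X q^j cancels against the denominator and leaves -(1 - X)(1 - b m X), which
      accounts for the last term of \<open>H (Suc N)\<close>.\<close>
    define g where "g j = - (X * (1 - q ^ j) * (1 - b * m * q ^ j) * (1 - b * X * q ^ j)
        / (q ^ j * (1 - b * q ^ (2 * j))))" for j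
    define G where "G j = h (Suc N) j * g j" for j
    have step: "(1 - q * q ^ N) * (1 - b * m * q * q ^ N) * h (Suc N) j - h N j = G (Suc j) - G j"
      if "j \<le> N" for j
    proof -
      define u where "u = q ^ j"
      have u0: "u \<noteq> 0" using q by (simp add: u_def)
      have sk: "Suc N - j = Suc (N - j)" using that by simp
      have Xu: "X / u = q * q ^ (N - j)"
        using that q by (simp add: X_def u_def power_diff)
      have nz: "1 - X / u \<noteq> 0" "1 - b * X * u \<noteq> 0" "1 - b * u * u \<noteq> 0" "1 - q * u \<noteq> 0"
        "1 - b * m * q * u \<noteq> 0" "1 - b * X * q * u \<noteq> 0" "1 - b * q * q * u * u \<noteq> 0"
      proof -
        show "1 - X / u \<noteq> 0"
          unfolding Xu by (rule qk)
        show "1 - b * X * u \<noteq> 0"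
          using qk(2)[of "N + j + 1"] by (simp add: X_def u_def power_add mult_ac)
        show "1 - b * u * u \<noteq> 0"
          using qk(2)[of "j + j"] by (simp add: u_def power_add mult_ac)
        show "1 - q * u \<noteq> 0" "1 - b * m * q * u \<noteq> 0"
          using qk[of j] by (simp_all add: u_def)
        show "1 - b * X * q * u \<noteq> 0"
          using qk(2)[of "N + j + 2"] by (simp add: X_def u_def power_add power2_eq_square mult_ac)
        show "1 - b * q * q * u * u \<noteq> 0"
          using qk(2)[of "Suc j + Suc j"] by (simp add: u_def power_add mult_ac)
      qed
      have hN: "h N j = h (Suc N) j * ((1 - X / u) * (1 - b * X * u))"
      proof -
        have "qpoch_fin q b (Suc N + j + 1) = qpoch_fin q b (N + j + 1) * (1 - b * X * u)"
          by (simp add: qpoch_fin_Suc X_def u_def power_add mult_ac)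
        moreover have "qpoch_fin q q (Suc N - j) = qpoch_fin q q (N - j) * (1 - X / u)"
          unfolding sk qpoch_fin_Suc Xu ..
        ultimately show ?thesis
          unfolding h_def using nz u0 by simp
      qed
      have wS: "w (Suc j) = w j * (u - m) / (u * (1 - b * m * q * u))"
        using w[of j] nz u0 by (simp add: u_def field_simps)
      have eS: "e (Suc j) = e j * ((1 - b * q * q * u * u) / (1 - b * u * u) * (- b) * q * u * u * (1 - b * u)
           * (u - m) / ((1 - q * u) * (1 - b * m * q * u)))"
      proof -
        have p1: "q ^ (Suc j + 3 * (Suc j choose 2)) = q ^ (j + 3 * (j choose 2)) * q * u * u * u"
          by (simp add: numeral_2_eq_2 u_def power_add power_mult_distrib eval_nat_numeral mult_ac flip: power_mult)
        have p2: "q ^ (2 * Suc j) = q * q * u * u" "q ^ (2 * j) = u * u"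
          unfolding pw by (simp_all add: u_def mult_ac)
        have p3: "qpoch_fin q b (Suc j) = qpoch_fin q b j * (1 - b * u)"
          "qpoch_fin q q (Suc j) = qpoch_fin q q j * (1 - q * u)"
          by (simp_all add: qpoch_fin_Suc u_def)
        show ?thesis
          unfolding e_def wS p1 p2 p3 using nz u0 P by (simp add: mult_ac)
      qed
      have hS: "h (Suc N) (Suc j) = h (Suc N) j * ((1 - b * q * q * u * u) / (1 - b * u * u) * (- b) * q * u * u * (1 - b * u)
           * (u - m) / ((1 - q * u) * (1 - b * m * q * u)) * (1 - X / u) / (1 - b * X * q * u))"
      proof -
        have "qpoch_fin q b (Suc N + Suc j + 1) = qpoch_fin q b (Suc N + j + 1) * (1 - b * X * q * u)"
          by (simp add: qpoch_fin_Suc X_def u_def power_add mult_ac)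
        moreover have "qpoch_fin q q (Suc N - j) = qpoch_fin q q (Suc N - Suc j) * (1 - X / u)"
          unfolding sk qpoch_fin_Suc Xu by simp
        ultimately show ?thesis
          unfolding h_def eS using nz u0 by (simp add: mult_ac)
      qed
      have gj: "g j = - (X * (1 - u) * (1 - b * m * u) * (1 - b * X * u) / (u * (1 - b * u * u)))"
        unfolding g_def pw by (simp add: u_def mult_ac)
      have gS: "g (Suc j) = - (X * (1 - q * u) * (1 - b * m * q * u) * (1 - b * X * q * u)
           / (q * u * (1 - b * q * q * u * u)))"
        unfolding g_def pw by (simp add: u_def mult_ac)
      have G1: "G (Suc j) = h (Suc N) j * (X * b * (1 - b * u) * (u - m) * (u - X) / (1 - b * u * u))"
        unfolding G_def hS gS using nz u0 q by (simp add: divide_simps) (simp add: mult_ac)?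
      \<comment> \<open>With all neighbouring terms expressed through \<open>h (Suc N) j\<close>,
        the telescoping step is this rational identity.\<close>
      have cert: "(1 - X) * (1 - b*m*X) - (1 - X / u) * (1 - b*X*u)
          = X * b * (1 - b*u) * (u - m) * (u - X) / (1 - b * u * u) - g j"
        using change_of_base_certificate[of X b m u] nz(3) u0 unfolding gj
        by (simp add: divide_simps) (simp add: algebra_simps)
      have "(1 - q * q ^ N) * (1 - b * m * q * q ^ N) * h (Suc N) j - h N j
         = h (Suc N) j * ((1 - X) * (1 - b*m*X) - (1 - X / u) * (1 - b*X*u))"
        unfolding hN by (simp add: X_def algebra_simps)
      also have "\<dots> = G (Suc j) - G j"
        unfolding cert G1 by (simp add: G_def right_diff_distrib)
      finally show ?thesis .
    qed
    have "(1 - q * q ^ N) * (1 - b * m * q * q ^ N) * (\<Sum>j\<le>N. h (Suc N) j) - H N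
        = (\<Sum>j\<le>N. G (Suc j) - G j)"
      unfolding H_def sum_distrib_left sum_subtractf[symmetric]
      by (intro sum.cong step) auto
    also have "\<dots> = G (Suc N)"
      by (simp add: sum_atMost_telescope G_def[of 0] g_def)
    also have "\<dots> = - ((1 - q * q ^ N) * (1 - b * m * q * q ^ N) * h (Suc N) (Suc N))"
    proof -
      have "1 - b * X * X \<noteq> 0"
        using qk(2)[of "Suc N + Suc N"] by (simp add: X_def power_add mult_ac)
      moreover have "q ^ Suc N = X" "q ^ (2 * Suc N) = X * X" "X \<noteq> 0"
        using q unfolding pw by (simp_all add: X_def mult_ac)
      ultimately have "g (Suc N) = - ((1 - X) * (1 - b * m * X))"
        by (simp add: g_def mult.assoc)
      then show ?thesis
        by (simp add: G_def X_def mult_ac)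
    qed
    finally show ?thesis
      unfolding H_def[of "Suc N"] by (simp add: algebra_simps)
  qed
  have "H N = w 0 / (qpoch_fin q q N * qpoch_fin q (b * m * q) N)"
  proof (induction N)
    case 0
    then show ?case using qk(2)[of 0] by (simp add: H_def h_def e_def qpoch_fin_Suc numeral_2_eq_2)
  next
    case (Suc N)
    have "H (Suc N) = H N / ((1 - q * q ^ N) * (1 - b * m * q * q ^ N))"
      using rec[of N] qk[of N] by (simp add: eq_divide_eq mult_ac)
    then show ?case
      by (simp add: Suc.IH qpoch_fin_Suc mult_ac)
  qed
  then show ?thesis
    by (simp add: H_def h_def e_def mult_ac)
qed

section \<open>The bilateral Bailey lemma relative to a\<close>

lemma power_int_eq_mult_power:
  fixes q :: complex
  assumes "q \<noteq> 0" "x = y + int k"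
  shows "q powi x = q powi y * q ^ k"
  using assms by (simp add: power_int_add)

text \<open>The factor by which Bailey's lemma with unchanged base multiplies \<alpha>.\<close>

definition bailey_weight :: "complex \<Rightarrow> complex \<Rightarrow> complex \<Rightarrow> complex \<Rightarrow> int \<Rightarrow> complex" where
  "bailey_weight q a \<rho> \<sigma> r =
     qpoch q \<rho> r * qpoch q \<sigma> r * (a * q / (\<rho> * \<sigma>)) powi r
       / (qpoch q (a * q / \<rho>) r * qpoch q (a * q / \<sigma>) r)"

text \<open>Putting j = r + i and M = n - r turns the sum into q-Pfaff-Saalschuetz with b = a
  q^(2r), c = aq/(rho sigma) and parameters rho q^r, sigma q^r.\<close>

lemma lattice_beta_coeff_sum:
  fixes a q \<rho> \<sigma> :: complex and r n :: int
  assumes q: "norm q < 1" "q \<noteq> 0" and nz: "a \<noteq> 0" "\<rho> \<noteq> 0" "\<sigma> \<noteq> 0"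
    and a: "\<And>k::int. a * q powi k \<noteq> 1"
    and \<rho>: "\<And>k::int. \<rho> * q powi k \<noteq> 1"
    and \<sigma>: "\<And>k::int. \<sigma> * q powi k \<noteq> 1"
    and c: "\<And>k::nat. a * q / (\<rho> * \<sigma>) * q ^ k \<noteq> 1"
    and rn: "r \<le> n"
  shows "(\<Sum>j = r..n. lattice_beta_coeff q a \<rho> \<sigma> n j / (qpoch q q (j - r) * qpoch q (a * q) (j + r)))
     = bailey_weight q a \<rho> \<sigma> r / (qpoch q q (n - r) * qpoch q (a * q) (n + r))"
proof -
  define M where "M = nat (n - r)"
  define b where "b = a * q powi (2 * r)"
  define c where "c = a * q / (\<rho> * \<sigma>)"
  define \<rho>' \<sigma>' where "\<rho>' = \<rho> * q powi r" and "\<sigma>' = \<sigma> * q powi r"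
  have n: "n = r + int M"
    using rn by (simp add: M_def)
  have q2r: "q powi (2 * r) = q powi r * q powi r"
    using q by (simp flip: power_int_add)
  have aq: "a * q * q powi k \<noteq> 1" for k
    using a[of "k + 1"] q by (simp add: power_int_add mult_ac)
  have bq: "b * q * q ^ i \<noteq> 1" for i
    using aq[of "2 * r + int i"] q by (simp add: b_def power_int_add mult_ac)
  have bc: "b * q = c * \<rho>' * \<sigma>'"
    using nz by (simp add: b_def c_def \<rho>'_def \<sigma>'_def q2r)
  have c\<sigma>: "c * \<sigma>' = a * q / \<rho> * q powi r" and c\<rho>: "c * \<rho>' = a * q / \<sigma> * q powi r"
    using nz by (simp_all add: c_def \<rho>'_def \<sigma>'_def)
  define Z where "Z = qpoch q \<rho> r * qpoch q \<sigma> r * c powi r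
      / (qpoch q (a * q / \<rho>) n * qpoch q (a * q / \<sigma>) n * qpoch q (a * q) (2 * r))"
  have c0: "c \<noteq> 0"
    using nz q by (simp add: c_def)
  have aq_split: "qpoch q (a * q) (2 * r + int i) = qpoch q (a * q) (2 * r) * qpoch_fin q (b * q) i" for i
    using qpoch_add_nat[OF q aq, where m = i and k = "2 * r"] by (simp add: b_def mult_ac)
  have term_eq: "lattice_beta_coeff q a \<rho> \<sigma> n (r + int i)
        / (qpoch q q (r + int i - r) * qpoch q (a * q) (r + int i + r))
      = Z * (qpoch_fin q \<rho>' i * qpoch_fin q \<sigma>' i * c ^ i / (qpoch_fin q q i * qpoch_fin q (b * q) i)
            * (qpoch_fin q c (M - i) / qpoch_fin q q (M - i)))" if "i \<le> M" for i
  proof -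
    have d: "n - (r + int i) = int (M - i)" "r + int i + r = 2 * r + int i" "r + int i - r = int i"
      using that n by auto
    have "qpoch q \<rho> (r + int i) = qpoch q \<rho> r * qpoch_fin q \<rho>' i"
         "qpoch q \<sigma> (r + int i) = qpoch q \<sigma> r * qpoch_fin q \<sigma>' i"
      using qpoch_add_nat[OF q \<rho>] qpoch_add_nat[OF q \<sigma>] by (simp_all add: \<rho>'_def \<sigma>'_def)
    moreover have "qpoch q c (int (M - i)) = qpoch_fin q c (M - i)"
      using qpoch_of_nat[OF q] assms(9) by (simp add: c_def)
    moreover have "c powi (r + int i) = c powi r * c ^ i"
      using c0 by (simp add: power_int_add)
    ultimately show ?thesis
      unfolding lattice_beta_coeff_def c_def[symmetric] d aq_split qpoch_q_of_nat[OF q] Z_def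
      by (simp add: mult_ac)
  qed
  have "(\<Sum>j = r..n. lattice_beta_coeff q a \<rho> \<sigma> n j / (qpoch q q (j - r) * qpoch q (a * q) (j + r)))
      = (\<Sum>i\<le>M. lattice_beta_coeff q a \<rho> \<sigma> n (r + int i)
          / (qpoch q q (r + int i - r) * qpoch q (a * q) (r + int i + r)))"
    by (rule sum.reindex_bij_witness[of _ "\<lambda>i. r + int i" "\<lambda>j. nat (j - r)"]) (auto simp: n)
  also have "\<dots> = Z * (\<Sum>i\<le>M. qpoch_fin q \<rho>' i * qpoch_fin q \<sigma>' i * c ^ i
      / (qpoch_fin q q i * qpoch_fin q (b * q) i) * (qpoch_fin q c (M - i) / qpoch_fin q q (M - i)))"
    unfolding sum_distrib_left by (intro sum.cong term_eq) auto
  also have "\<dots> = Z * (qpoch_fin q (c * \<sigma>') M * qpoch_fin q (c * \<rho>') M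
      / (qpoch_fin q q M * qpoch_fin q (b * q) M))"
    by (subst q_Pfaff_Saalschutz[OF q(1) bc bq]) simp
  also have "\<dots> = bailey_weight q a \<rho> \<sigma> r / (qpoch q q (n - r) * qpoch q (a * q) (n + r))"
  proof -
    have d: "n - r = int M" "n + r = 2 * r + int M"
      using n by auto
    \<comment> \<open>The two numerators of the closed form lower the index of 1/(aq/rho)_n and
      1/(aq/sigma)_n from n to r.\<close>
    have "inverse (qpoch q (a * q / \<rho>) r) = qpoch_fin q (c * \<sigma>') M * inverse (qpoch q (a * q / \<rho>) n)"
         "inverse (qpoch q (a * q / \<sigma>) r) = qpoch_fin q (c * \<rho>') M * inverse (qpoch q (a * q / \<sigma>) n)"
      unfolding n c\<sigma> c\<rho> by (rule inverse_qpoch_shift[OF q])+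
    then show ?thesis
      unfolding bailey_weight_def c_def[symmetric] d aq_split qpoch_q_of_nat[OF q] Z_def
      by (simp add: divide_inverse mult_ac)
  qed
  finally show ?thesis .
qed

lemma has_sum_int_atMost_iff:
  "(f has_sum S) {..n::int} \<longleftrightarrow> ((\<lambda>k. f (n - int k)) has_sum S) UNIV"
  by (rule has_sum_reindex_bij_witness[of _ "\<lambda>k. n - int k" "\<lambda>j. nat (n - j)"]) auto

text \<open>Absolute convergence allows the double series to be summed in either order: over r first
  it gives the series for \<beta>', over j first the finite sums just evaluated.\<close>

lemma lattice_beta_series:
  fixes a q \<rho> \<sigma> :: complex and \<alpha> \<beta> :: "int \<Rightarrow> complex"
  assumes q: "norm q < 1" "q \<noteq> 0" and nz: "a \<noteq> 0" "\<rho> \<noteq> 0" "\<sigma> \<noteq> 0"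
    and a: "\<And>k::int. a * q powi k \<noteq> 1"
    and \<rho>: "\<And>k::int. \<rho> * q powi k \<noteq> 1"
    and \<sigma>: "\<And>k::int. \<sigma> * q powi k \<noteq> 1"
    and c: "\<And>k::nat. a * q / (\<rho> * \<sigma>) * q ^ k \<noteq> 1"
    and pair: "bilateral_bailey_pair q a \<alpha> \<beta>"
    and conv: "lattice_abs_convergent q a \<rho> \<sigma> \<alpha>"
  shows "((\<lambda>r. bailey_weight q a \<rho> \<sigma> r * \<alpha> r / (qpoch q q (n - r) * qpoch q (a * q) (n + r)))
            has_sum lattice_beta q a \<rho> \<sigma> \<beta> n) {..n}"
proof -
  define f where "f j r = lattice_beta_coeff q a \<rho> \<sigma> n j *
      (\<alpha> r / (qpoch q q (j - r) * qpoch q (a * q) (j + r)))" for j r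
  define S where "S = infsum (\<lambda>(j, r). f j r) (Sigma {..n} (\<lambda>j. {..j}))"
  have A: "{(j, r). r \<le> j \<and> j \<le> n} = Sigma {..n} (\<lambda>j. {..j})"
    by auto
  have "(\<lambda>x. norm (case x of (j, r) \<Rightarrow> f j r)) summable_on Sigma {..n} (\<lambda>j. {..j})"
    using conv[unfolded lattice_abs_convergent_def, rule_format, of n]
    unfolding A f_def by (simp add: case_prod_unfold)
  then have summ: "(\<lambda>(j, r). f j r) summable_on Sigma {..n} (\<lambda>j. {..j})"
    by (rule abs_summable_summable)
  then have S: "((\<lambda>(j, r). f j r) has_sum S) (Sigma {..n} (\<lambda>j. {..j}))"
    unfolding S_def by (rule has_sum_infsum)
  have inner: "(f j has_sum lattice_beta_coeff q a \<rho> \<sigma> n j * \<beta> j) {..j}" if "j \<le> n" for j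
  proof -
    \<comment> \<open>The Bailey pair provides only an ordinary series. Unordered summability comes
      from the double series, and uniqueness of limits identifies the value.\<close>
    have "f j summable_on {..j}"
      by (rule summable_on_SigmaD1[OF summ]) (use that in auto)
    then obtain s where s: "(f j has_sum s) {..j}"
      by (auto simp: summable_on_def)
    then have "(\<lambda>k. f j (j - int k)) sums s"
      by (intro has_sum_imp_sums) (simp add: has_sum_int_atMost_iff)
    moreover have "(\<lambda>k. f j (j - int k)) sums (lattice_beta_coeff q a \<rho> \<sigma> n j * \<beta> j)"
      unfolding f_def using pair by (intro sums_mult) (simp add: bilateral_bailey_pair_def Let_def)
    ultimately show ?thesis
      using s sums_unique2 by blast
  qed
  have "((\<lambda>j. lattice_beta_coeff q a \<rho> \<sigma> n j * \<beta> j) has_sum S) {..n}"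
    by (rule has_sum_SigmaD[OF S]) (use inner in auto)
  then have "(\<lambda>k. lattice_beta_coeff q a \<rho> \<sigma> n (n - int k) * \<beta> (n - int k)) sums S"
    unfolding has_sum_int_atMost_iff by (rule has_sum_imp_sums)
  then have S_eq: "lattice_beta q a \<rho> \<sigma> \<beta> n = S"
    by (simp add: lattice_beta_def Let_def sums_iff)
  have "((\<lambda>(r, j). f j r) has_sum S) (Sigma {..n} (\<lambda>r. {r..n}))"
    using S by (subst has_sum_reindex_bij_witness[of _ "\<lambda>(j, r). (r, j)" "\<lambda>(r, j). (j, r)"
          "Sigma {..n} (\<lambda>j. {..j})" "\<lambda>(j, r). f j r" _ S S]) auto
  then have "((\<lambda>r. \<Sum>j = r..n. f j r) has_sum S) {..n}"
    by (rule has_sum_SigmaD) auto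
  moreover have "(\<Sum>j = r..n. f j r)
      = bailey_weight q a \<rho> \<sigma> r * \<alpha> r / (qpoch q q (n - r) * qpoch q (a * q) (n + r))" if "r \<le> n" for r
    using arg_cong[OF lattice_beta_coeff_sum[OF q nz a \<rho> \<sigma> c that], of "\<lambda>x. \<alpha> r * x"]
    by (simp add: f_def sum_distrib_left mult_ac)
  ultimately show ?thesis
    unfolding S_eq by (subst has_sum_cong) auto
qed

section \<open>Expansion of the kernel in the kernels relative to a q^(-N)\<close>

text \<open>The coefficient of the change of base \<open>a \<mapsto> a q\<^bsup>-N\<^esup>\<close>, that is, of the part of \<open>\<alpha>'\<close> that does
  not involve \<open>\<rho>\<close> and \<open>\<sigma>\<close>.\<close>

definition change_of_base_coeff :: "complex \<Rightarrow> complex \<Rightarrow> nat \<Rightarrow> int \<Rightarrow> int \<Rightarrow> complex" where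
  "change_of_base_coeff q a N n j =
     (1 - a * q powi (2 * n - int N)) * qpoch q (a * q powi (1 - int N)) (int N) *
     ((-1) powi j *
        (a powi j * q powi ((2 * n - int N) * j - j * (j + 1) div 2)
           / qpoch q (a * q powi (2 * n - int N - j)) (int N + 1)) * qbinom q N j)"

lemma lattice_alpha_eq:
  "lattice_alpha q a \<rho> \<sigma> N \<alpha> n = (\<Sum>i\<le>N. change_of_base_coeff q a N n (int i) *
      (bailey_weight q a \<rho> \<sigma> (n - int i) * \<alpha> (n - int i)))"
proof -
  have "(\<Sum>i\<le>N. change_of_base_coeff q a N n (int i) * (bailey_weight q a \<rho> \<sigma> (n - int i) * \<alpha> (n - int i)))
    = (\<Sum>j = 0..int N. change_of_base_coeff q a N n j * (bailey_weight q a \<rho> \<sigma> (n - j) * \<alpha> (n - j)))"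
    by (rule sum.reindex_bij_witness[of _ nat int]) auto
  then show ?thesis
    unfolding lattice_alpha_def change_of_base_coeff_def bailey_weight_def sum_distrib_left
    by (simp add: mult_ac)
qed

lemma double_choose_two: "2 * (i choose 2) + i = i * (i::nat)"
  by (induction i) (auto simp: numeral_2_eq_2)

text \<open>Here the source index r = n - j is fixed instead of n, so that the term depends on r
  only through b. The products (a q^(1-N))_inf of the prefactor and of the new kernel cancel, which
  leaves a summand of \<open>change_of_base_sum\<close>; the last bracket plays the role of
  \<open>w\<close>.\<close>

lemma change_of_base_coeff_eq:
  fixes a q :: complex and r :: int and k N i :: nat
  assumes q: "norm q < 1" "q \<noteq> 0" and a: "\<And>k::int. a * q powi k \<noteq> 1" and i: "i \<le> N"
  defines "b \<equiv> a * q powi (2 * r - int N)"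
  shows "change_of_base_coeff q a N (r + int i) (int i)
       / (qpoch q q (int k - int i) * qpoch q (a * q powi (- int N) * q) (2 * r + int k + int i))
     = qpoch_fin q q N / qpoch_inf q (a * q) *
       ((1 - b * q ^ (2 * i)) * (- b) ^ i * q ^ (i + 3 * (i choose 2)) * qpoch_fin q b i
            / (qpoch_fin q b (N + i + 1) * qpoch_fin q q i * qpoch_fin q q (N - i)) *
          (inverse (qpoch q q (int k - int i)) * qpoch_inf q (b * q ^ k * q * q ^ i)))"
proof -
  have inf_nz: "qpoch_inf q (a * q powi m) \<noteq> 0" for m
    using a[of "m + int _"] q by (auto simp: qpoch_inf_eq_0_iff power_int_add mult_ac)
  have bi: "b * q ^ i * q ^ m \<noteq> 1" for i m
    using a[of "2 * r - int N + int i + int m"] q by (simp add: b_def power_int_add mult_ac)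
  have P: "qpoch_fin q b m \<noteq> 0" for m
    using bi[of 0] by (intro qpoch_fin_nonzero) simp
  have e1: "a * q powi (2 * (r + int i) - int N) = b * q ^ (2 * i)"
    using power_int_eq_mult_power[OF q(2), of "2 * (r + int i) - int N" "2 * r - int N" "2 * i"]
    by (simp add: b_def)
  have e2: "qpoch q (a * q powi (1 - int N)) (int N) = qpoch_inf q (a * q powi (1 - int N)) / qpoch_inf q (a * q)"
    using q by (simp add: qpoch_def power_int_diff)
  have e3: "qpoch q (a * q powi (- int N) * q) (2 * r + int k + int i)
      = qpoch_inf q (a * q powi (1 - int N)) / qpoch_inf q (b * q ^ k * q * q ^ i)"
    unfolding qpoch_def b_def using q by (simp add: power_int_diff power_int_add power_int_minus field_simps)
  have e4: "qpoch q (a * q powi (2 * (r + int i) - int N - int i)) (int N + 1) = qpoch_fin q (b * q ^ i) (N + 1)"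
  proof -
    have "a * q powi (2 * (r + int i) - int N - int i) = b * q ^ i"
      using power_int_eq_mult_power[OF q(2), of "2 * (r + int i) - int N - int i" "2 * r - int N" i]
      by (simp add: b_def)
    then show ?thesis
      using qpoch_of_nat[OF q bi, of i "N + 1"] by (simp add: add.commute)
  qed
  \<comment> \<open>The exponent of q rests on 2 i^2 - i(i+1)/2 = i + 3 (i choose 2).\<close>
  have e5: "a powi int i * q powi ((2 * (r + int i) - int N) * int i - int i * (int i + 1) div 2)
      = b ^ i * q ^ (i + 3 * (i choose 2))"
  proof -
    have c2: "2 * int (i choose 2) + int i = int i * int i"
      using double_choose_two[of i] by (metis of_nat_add of_nat_mult of_nat_numeral)
    then have "int i * (int i + 1) = 2 * (int (i choose 2) + int i)"
      by (simp add: algebra_simps)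
    then have "int i * (int i + 1) div 2 = int (i choose 2) + int i"
      by simp
    then have "(2 * (r + int i) - int N) * int i - int i * (int i + 1) div 2
        = (2 * r - int N) * int i + int (i + 3 * (i choose 2))"
      using c2 by (simp add: algebra_simps)
    then show ?thesis
      using power_int_eq_mult_power[OF q(2) refl, of "(2 * r - int N) * int i" "i + 3 * (i choose 2)"]
      by (simp add: b_def power_mult_distrib power_int_mult)
  qed
  have e6: "qbinom q N (int i) = qpoch_fin q q N / (qpoch_fin q q i * qpoch_fin q q (N - i))"
    using i qpoch_q_of_nat[OF q] by (simp add: qbinom_def flip: of_nat_diff)
  have e7: "qpoch_fin q b (N + i + 1) = qpoch_fin q b i * qpoch_fin q (b * q ^ i) (N + 1)"
    using qpoch_fin_add[of q b i "N + 1"] by (simp add: add_ac)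
  have e8: "(- b) ^ i = (- 1) ^ i * b ^ i"
    by (rule power_minus)
  have e9: "(- 1 :: complex) powi int i = (- 1) ^ i"
    by simp
  show ?thesis
    unfolding change_of_base_coeff_def e1 e2 e3 e4 e5 e6 e7 e8 e9
    using inf_nz[of "1 - int N"] P[of i] by (simp add: divide_inverse mult_ac)
qed

text \<open>This is \<open>change_of_base_sum\<close> with m = q^k, where k = n - r. Terms with i >
  k vanish because 1/(q)_(k-i) = 0.\<close>

lemma change_of_base_coeff_sum:
  fixes a q :: complex and r :: int and k N :: nat
  assumes q: "norm q < 1" "q \<noteq> 0" and a: "\<And>k::int. a * q powi k \<noteq> 1"
  shows "(\<Sum>i\<le>N. change_of_base_coeff q a N (r + int i) (int i)
       / (qpoch q q (int k - int i) * qpoch q (a * q powi (- int N) * q) (2 * r + int k + int i)))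
     = 1 / (qpoch q q (int k) * qpoch q (a * q) (2 * r + int k))"
proof -
  define b where "b = a * q powi (2 * r - int N)"
  define w where "w i = inverse (qpoch q q (int k - int i)) * qpoch_inf q (b * q ^ k * q * q ^ i)" for i
  have bm: "b * q ^ m \<noteq> 1" for m
    using a[of "2 * r - int N + int m"] q by (simp add: b_def power_int_add mult_ac)
  have bkm: "b * q ^ k * q * q ^ m \<noteq> 1" for m
    using bm[of "k + 1 + m"] by (simp add: power_add mult_ac)
  \<comment> \<open>The ratio stays valid at i = k, where both sides are 0, and beyond it.\<close>
  have w: "w (Suc i) * (1 - b * q ^ k * q * q ^ i) * q ^ i = w i * (q ^ i - q ^ k)" for i
  proof -
    have "qpoch_inf q (b * q ^ k * q * q ^ i)
        = (1 - b * q ^ k * q * q ^ i) * qpoch_inf q (b * q ^ k * q * q ^ Suc i)"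
      using qpoch_inf_split[OF q(1), of "b * q ^ k * q * q ^ i" 1] by (simp add: qpoch_fin_Suc mult_ac)
    moreover have "inverse (qpoch q q (int k - int (Suc i))) * q ^ i
        = (q ^ i - q ^ k) * inverse (qpoch q q (int k - int i))"
    proof -
      have "q * q powi (int k - int (Suc i)) * q ^ i = q ^ k"
        using q by (simp add: power_int_diff power_int_add)
      then have "(1 - q * q powi (int k - int (Suc i))) * q ^ i = q ^ i - q ^ k"
        by (simp add: left_diff_distrib)
      then show ?thesis
        using inverse_qpoch_shift[OF q, of q "int k - int (Suc i)" 1] by (simp add: qpoch_fin_Suc mult_ac)
    qed
    ultimately show ?thesis
      by (simp add: w_def mult_ac)
  qed
  have "(\<Sum>i\<le>N. change_of_base_coeff q a N (r + int i) (int i)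
       / (qpoch q q (int k - int i) * qpoch q (a * q powi (- int N) * q) (2 * r + int k + int i)))
     = qpoch_fin q q N / qpoch_inf q (a * q) * (\<Sum>i\<le>N.
        (1 - b * q ^ (2 * i)) * (- b) ^ i * q ^ (i + 3 * (i choose 2)) * qpoch_fin q b i
            / (qpoch_fin q b (N + i + 1) * qpoch_fin q q i * qpoch_fin q q (N - i)) * w i)"
    unfolding sum_distrib_left w_def b_def
    by (intro sum.cong change_of_base_coeff_eq q a) auto
  also have "\<dots> = qpoch_fin q q N / qpoch_inf q (a * q) * (w 0 / (qpoch_fin q q N * qpoch_fin q (b * q ^ k * q) N))"
    by (subst change_of_base_sum[OF q bm bkm w]) simp
  also have "\<dots> = 1 / (qpoch q q (int k) * qpoch q (a * q) (2 * r + int k))"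
  proof -
    \<comment> \<open>Since b q^N = a q^(2r), splitting N factors off \<open>w 0\<close> leaves
      exactly the infinite product of the kernel relative to a.\<close>
    have e: "b * q ^ k * q * q ^ N = a * q * q powi (2 * r + int k)"
      using q by (simp add: b_def power_int_diff power_int_add)
    have "w 0 = inverse (qpoch q q (int k)) *
        (qpoch_fin q (b * q ^ k * q) N * qpoch_inf q (a * q * q powi (2 * r + int k)))"
      using qpoch_inf_split[OF q(1), of "b * q ^ k * q" N, unfolded e] by (simp add: w_def)
    moreover have "qpoch_fin q (b * q ^ k * q) N \<noteq> 0"
      using bkm by (intro qpoch_fin_nonzero)
    ultimately show ?thesis
      using qpoch_fin_q_nonzero[OF q(1), of N] unfolding qpoch_def[of q "a * q"]
      by (simp add: divide_simps)
  qed
  finally show ?thesis .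
qed

section \<open>Uniform bounds for the terms of the expansion\<close>

text \<open>Multiplying numerator and denominator by u^(2(i+d)) with u = q^k gives a rational
  function of u whose denominator tends to a nonzero limit as u tends to 0.\<close>

lemma Bseq_well_poised_ratio:
  fixes B C q :: complex and f g :: "nat \<Rightarrow> complex"
  assumes q: "norm q < 1" "q \<noteq> 0" and B: "B \<noteq> 0" and I: "finite I" "card I = i + d"
    and f: "\<And>l. l \<in> I \<Longrightarrow> f l \<noteq> 0"
  shows "Bseq (\<lambda>k. (B / (q ^ k)\<^sup>2) ^ i * (\<Prod>l<d. 1 - C / q ^ k * g l) / (\<Prod>l\<in>I. 1 - B / (q ^ k)\<^sup>2 * f l))"
proof -
  have u: "(\<lambda>k. q ^ k) \<longlonglongrightarrow> 0"
    using q by (intro LIMSEQ_power_zero) auto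
  have "(\<lambda>k. B ^ i * (\<Prod>l<d. (q ^ k)\<^sup>2 - C * q ^ k * g l) / (\<Prod>l\<in>I. (q ^ k)\<^sup>2 - B * f l))
     \<longlonglongrightarrow> B ^ i * (\<Prod>l<d. 0\<^sup>2 - C * 0 * g l) / (\<Prod>l\<in>I. 0\<^sup>2 - B * f l)"
    using I B f by (intro tendsto_intros u) auto
  then have "Bseq (\<lambda>k. B ^ i * (\<Prod>l<d. (q ^ k)\<^sup>2 - C * q ^ k * g l) / (\<Prod>l\<in>I. (q ^ k)\<^sup>2 - B * f l))"
    by (intro convergent_imp_Bseq convergentI)
  also have "(\<lambda>k. B ^ i * (\<Prod>l<d. (q ^ k)\<^sup>2 - C * q ^ k * g l) / (\<Prod>l\<in>I. (q ^ k)\<^sup>2 - B * f l))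
     = (\<lambda>k. (B / (q ^ k)\<^sup>2) ^ i * (\<Prod>l<d. 1 - C / q ^ k * g l) / (\<Prod>l\<in>I. 1 - B / (q ^ k)\<^sup>2 * f l))"
  proof
    fix k
    define u where "u = q ^ k"
    have u: "u \<noteq> 0"
      using q by (simp add: u_def)
    have "(\<Prod>l<d. u\<^sup>2 - C * u * g l) = (\<Prod>l<d. u\<^sup>2 * (1 - C / u * g l))"
      using u by (intro prod.cong refl) (simp add: power2_eq_square field_simps)
    then have "(\<Prod>l<d. u\<^sup>2 - C * u * g l) = (u\<^sup>2) ^ d * (\<Prod>l<d. 1 - C / u * g l)"
      by (simp add: prod.distrib)
    moreover have "(\<Prod>l\<in>I. u\<^sup>2 - B * f l) = (\<Prod>l\<in>I. u\<^sup>2 * (1 - B / u\<^sup>2 * f l))"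
      using u by (intro prod.cong refl) (simp add: field_simps)
    then have "(\<Prod>l\<in>I. u\<^sup>2 - B * f l) = (u\<^sup>2) ^ (i + d) * (\<Prod>l\<in>I. 1 - B / u\<^sup>2 * f l)"
      by (simp add: prod.distrib I)
    moreover have "(B / u\<^sup>2) ^ i = B ^ i / (u\<^sup>2) ^ i"
      by (rule power_divide)
    ultimately show "B ^ i * (\<Prod>l<d. (q ^ k)\<^sup>2 - C * q ^ k * g l) / (\<Prod>l\<in>I. (q ^ k)\<^sup>2 - B * f l)
        = (B / (q ^ k)\<^sup>2) ^ i * (\<Prod>l<d. 1 - C / q ^ k * g l) / (\<Prod>l\<in>I. 1 - B / (q ^ k)\<^sup>2 * f l)"
      using u unfolding u_def[symmetric] by (simp add: power_add)
  qed
  finally show ?thesis .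
qed

text \<open>With r = n - k, the quotient of the i-th term by the original kernel is a constant times
  \<open>R1 k * R2 k\<close>, and both sequences converge as k grows.\<close>

lemma change_of_base_coeff_bound:
  fixes a q :: complex and n :: int and N i :: nat
  assumes q: "norm q < 1" "q \<noteq> 0" and a0: "a \<noteq> 0" and a: "\<And>k::int. a * q powi k \<noteq> 1" and i: "i \<le> N"
  obtains K where "\<And>k::nat. norm (change_of_base_coeff q a N (n - int k + int i) (int i)
       / (qpoch q q (int k - int i) * qpoch q (a * q powi (- int N) * q) (2 * (n - int k) + int k + int i)))
     \<le> K * norm (1 / (qpoch q q (int k) * qpoch q (a * q) (2 * (n - int k) + int k)))"
proof -
  define B where "B = a * q powi (2 * n - int N)"
  define C where "C = a * q powi (1 - int N + 2 * n + int i)"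
  \<comment> \<open>The index i is left out because the very-well-poised factor 1 - b q^(2i) cancels
    it; N = i + (N - i) factors remain, as \<open>Bseq_well_poised_ratio\<close> demands.\<close>
  define I where "I = {..N} - {i}"
  define R1 where "R1 k = (B / (q ^ k)\<^sup>2) ^ i * (\<Prod>l<N - i. 1 - C / q ^ k * q ^ l)
      / (\<Prod>l\<in>I. 1 - B / (q ^ k)\<^sup>2 * (q ^ i * q ^ l))" for k
  \<comment> \<open>This is (q^(k-i+1))_i, the quotient of 1/(q)_(k-i) by 1/(q)_k; it is 0 for k <
    i.\<close>
  define R2 where "R2 k = qpoch_fin q (q powi (1 - int i) * q ^ k) i" for k
  define c where "c = qpoch_fin q q N * (- 1) ^ i * q ^ (i + 3 * (i choose 2)) / (qpoch_fin q q i * qpoch_fin q q (N - i))"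
  have R1: "Bseq R1"
    unfolding R1_def
  proof (rule Bseq_well_poised_ratio[OF q])
    show "card I = i + (N - i)"
      using i by (simp add: I_def)
  qed (use q a0 in \<open>auto simp: B_def I_def\<close>)
  have u: "(\<lambda>k. q ^ k) \<longlonglongrightarrow> 0"
    using q by (intro LIMSEQ_power_zero) auto
  have "R2 \<longlonglongrightarrow> (\<Prod>l<i. 1 - q powi (1 - int i) * 0 * q ^ l)"
    unfolding R2_def qpoch_fin_def by (intro tendsto_intros u)
  then have "Bseq R2"
    by (intro convergent_imp_Bseq convergentI)
  then have "Bseq (\<lambda>k. c * (R1 k * R2 k))"
    using R1 by (intro Bseq_mult Bseq_mult[of "\<lambda>_. c"]) auto
  then obtain K where K: "\<And>k. norm (c * (R1 k * R2 k)) \<le> K"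
    unfolding Bseq_def by blast
  have "change_of_base_coeff q a N (n - int k + int i) (int i)
       / (qpoch q q (int k - int i) * qpoch q (a * q powi (- int N) * q) (2 * (n - int k) + int k + int i))
     = c * (R1 k * R2 k) * (1 / (qpoch q q (int k) * qpoch q (a * q) (2 * (n - int k) + int k)))" for k
  proof -
    define b where "b = a * q powi (2 * (n - int k) - int N)"
    have bm: "b * q ^ m \<noteq> 1" for m
      using a[of "2 * (n - int k) - int N + int m"] q by (simp add: b_def power_int_add mult_ac)
    have bB: "B / (q ^ k)\<^sup>2 = b"
      using power_int_eq_mult_power[OF q(2), of "2 * n - int N" "2 * (n - int k) - int N" "k + k"] q
      by (simp add: B_def b_def power_add power2_eq_square)
    have bC: "b * q ^ k * q * q ^ i = C / q ^ k"
      using power_int_eq_mult_power[OF q(2), of "1 - int N + 2 * n + int i" "2 * (n - int k) - int N" "k + k + 1 + i"] q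
      by (simp add: C_def b_def power_add)
    have CA: "C / q ^ k * q ^ (N - i) = a * q * q powi (2 * (n - int k) + int k)"
      using power_int_eq_mult_power[OF q(2), of "1 + 2 * n" "1 - int N + 2 * n + int i" "N - i"] q i
        power_int_eq_mult_power[OF q(2), of "1 + 2 * n" "2 * (n - int k) + int k" "k + 1"]
      by (simp add: C_def divide_simps mult_ac)
    have s1: "inverse (qpoch q q (int k - int i)) = R2 k * inverse (qpoch q q (int k))"
    proof -
      have "q * q powi (int k - int i) = q powi (1 - int i) * q ^ k"
        using q by (simp add: power_int_diff)
      then show ?thesis
        using inverse_qpoch_shift[OF q, of q "int k - int i" i] by (simp add: R2_def)
    qed
    have s2: "qpoch_inf q (C / q ^ k) = (\<Prod>l<N - i. 1 - C / q ^ k * q ^ l)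
        * qpoch_inf q (a * q * q powi (2 * (n - int k) + int k))"
      using qpoch_inf_split[OF q(1), of "C / q ^ k" "N - i", unfolded CA] by (simp add: qpoch_fin_def)
    have s3: "qpoch_fin q b (N + i + 1)
        = qpoch_fin q b i * ((1 - b * q ^ (2 * i)) * (\<Prod>l\<in>I. 1 - b * (q ^ i * q ^ l)))"
    proof -
      have "qpoch_fin q b (N + i + 1) = qpoch_fin q b i * qpoch_fin q (b * q ^ i) (N + 1)"
        using qpoch_fin_add[of q b i "N + 1"] by (simp add: add_ac)
      also have "qpoch_fin q (b * q ^ i) (N + 1) = (\<Prod>l\<le>N. 1 - b * (q ^ i * q ^ l))"
        by (simp add: qpoch_fin_def lessThan_Suc_atMost mult.assoc)
      also have "\<dots> = (1 - b * (q ^ i * q ^ i)) * (\<Prod>l\<in>I. 1 - b * (q ^ i * q ^ l))"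
        unfolding I_def using i by (intro prod.remove) auto
      also have "q ^ i * q ^ i = q ^ (2 * i)"
        by (simp add: mult_2 power_add)
      finally show ?thesis .
    qed
    have nz: "qpoch_fin q b i \<noteq> 0" "1 - b * q ^ (2 * i) \<noteq> 0"
      using bm by (auto intro!: qpoch_fin_nonzero)
    have s4: "(- b) ^ i = (- 1) ^ i * b ^ i"
      by (rule power_minus)
    show ?thesis
      unfolding change_of_base_coeff_eq[OF q a i] b_def[symmetric] bC s1 s2 s3 s4 c_def R1_def bB
        qpoch_def[of q "a * q"]
      using nz by (simp add: divide_inverse mult_ac)
  qed
  then show ?thesis
    using K by (intro that[of K]) (auto simp only: norm_mult intro!: mult_right_mono norm_ge_zero)
qed

section \<open>Rearrangement of the series for the new pair\<close>

theorem theorem3p3: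
  fixes a q \<rho> \<sigma> :: complex and N :: nat and \<alpha> \<beta> :: "int \<Rightarrow> complex"
  assumes "norm q < 1" and "q \<noteq> 0" and "a \<noteq> 0" and "\<rho> \<noteq> 0" and "\<sigma> \<noteq> 0"
    and "\<And>k::int. a * q powi k \<noteq> 1"
    and "\<And>k::int. \<rho> * q powi k \<noteq> 1"
    and "\<And>k::int. \<sigma> * q powi k \<noteq> 1"
    and "\<And>k::nat. a * q / \<rho> * q ^ k \<noteq> 1"
    and "\<And>k::nat. a * q / \<sigma> * q ^ k \<noteq> 1"
    and "\<And>k::nat. a * q / (\<rho> * \<sigma>) * q ^ k \<noteq> 1"
    and "bilateral_bailey_pair q a \<alpha> \<beta>"
    and "lattice_abs_convergent q a \<rho> \<sigma> \<alpha>"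
  shows "bilateral_bailey_pair q (a * q powi (- int N))
           (lattice_alpha q a \<rho> \<sigma> N \<alpha>) (lattice_beta q a \<rho> \<sigma> \<beta>)"
  unfolding bilateral_bailey_pair_def Let_def
proof
  fix n :: int
  note q = assms(1,2) and a = assms(6)
  \<comment> \<open>All series are indexed by k = n - r: \<open>w\<close> is the weighted \<alpha>,
    \<open>K\<close> the kernel relative to a, and \<open>L i\<close> the i-th term of its
    expansion.\<close>
  define w where "w k = bailey_weight q a \<rho> \<sigma> (n - int k) * \<alpha> (n - int k)" for k
  define K where "K k = 1 / (qpoch q q (int k) * qpoch q (a * q) (2 * (n - int k) + int k))" for k
  define L where "L i k = change_of_base_coeff q a N (n - int k + int i) (int i)
       / (qpoch q q (int k - int i) * qpoch q (a * q powi (- int N) * q) (2 * (n - int k) + int k + int i))"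
    for i k
  have "((\<lambda>k. K k * w k) has_sum lattice_beta q a \<rho> \<sigma> \<beta> n) UNIV"
    using lattice_beta_series[OF assms(1-8,11-13), of n]
    unfolding has_sum_int_atMost_iff by (simp add: K_def w_def algebra_simps)
  then have sums: "(\<lambda>k. K k * w k) sums lattice_beta q a \<rho> \<sigma> \<beta> n"
    and "(\<lambda>k. K k * w k) summable_on UNIV"
    by (auto intro: has_sum_imp_sums simp: summable_on_def)
  \<comment> \<open>For complex terms, unordered summability is the same as absolute
    convergence.\<close>
  then have summ: "summable (\<lambda>k. norm (K k * w k))"
    by (intro summable_on_imp_summable) (simp flip: summable_on_iff_abs_summable_on_complex)
  have L_summable: "summable (\<lambda>k. L i k * w k)" if i: "i \<le> N" for i
  proof -
    obtain c where c: "\<And>k. norm (L i k) \<le> c * norm (K k)"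
      using change_of_base_coeff_bound[OF q assms(3) a i, where n = n] unfolding L_def K_def by blast
    have "norm (L i k * w k) \<le> c * norm (K k * w k)" for k
      using mult_right_mono[OF c[of k], of "norm (w k)"] by (simp add: norm_mult mult.assoc)
    then show ?thesis
      by (intro summable_comparison_test'[OF summable_mult[OF summ]]) auto
  qed
  \<comment> \<open>The term of \<alpha>' at n - k with index i uses \<alpha> at n - (k + i), hence
    the shift. The i terms it drops vanish since 1/(q)_(k-i) = 0 for k < i.\<close>
  have L_sums: "(\<lambda>k. L i (k + i) * w (k + i)) sums (\<Sum>k. L i k * w k)" if "i \<le> N" for i
  proof -
    have "L i k * w k = 0" if "k < i" for k
      using qpoch_q_neg[OF q, of "int k - int i"] that by (simp add: L_def)
    then show ?thesis
      using L_summable[OF that] by (subst sums_zero_iff_shift[of i "\<lambda>k. L i k * w k"]) auto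
  qed
  have "(\<lambda>k. \<Sum>i\<le>N. L i (k + i) * w (k + i)) sums (\<Sum>i\<le>N. \<Sum>k. L i k * w k)"
    by (intro sums_sum L_sums) auto
  \<comment> \<open>Only finitely many convergent series are added, so the sums may be exchanged;
    the kernel expansion then collapses the inner sum to \<open>K k * w k\<close>.\<close>
  also have "(\<Sum>i\<le>N. \<Sum>k. L i k * w k) = (\<Sum>k. \<Sum>i\<le>N. L i k * w k)"
    by (intro suminf_sum[symmetric] L_summable) auto
  also have "(\<lambda>k. \<Sum>i\<le>N. L i k * w k) = (\<lambda>k. K k * w k)"
    unfolding L_def K_def sum_distrib_right[symmetric] change_of_base_coeff_sum[OF q a] ..
  also have "(\<Sum>k. K k * w k) = lattice_beta q a \<rho> \<sigma> \<beta> n"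
    using sums by (simp add: sums_iff)
  also have "(\<lambda>k. \<Sum>i\<le>N. L i (k + i) * w (k + i))
      = (\<lambda>k. lattice_alpha q a \<rho> \<sigma> N \<alpha> (n - int k)
          / (qpoch q q (n - (n - int k)) * qpoch q (a * q powi (- int N) * q) (n + (n - int k))))"
    by (simp add: lattice_alpha_eq L_def w_def sum_divide_distrib algebra_simps)
  finally show "(\<lambda>k. lattice_alpha q a \<rho> \<sigma> N \<alpha> (n - int k)
      / (qpoch q q (n - (n - int k)) * qpoch q (a * q powi (- int N) * q) (n + (n - int k))))
      sums lattice_beta q a \<rho> \<sigma> \<beta> n" .
qed

end
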